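(* Let $d\ge1$ be an integer, $A,\bar A\in\mathbb R^{n\times n}$, $B,\bar B\in\mathbb R^{n\times m}$. For given $K\in\mathbb R^{m\times n}$ and symmetric $Q\in\mathbb R^{n\times n}$ with $Q\ge0$, assume that $(A-BK,\bar A-\bar BK\,|\,Q^{1/2})$ is exactly observable. If there exist matrices $P^i>0$, $i=0,\dots,d$, satisfying $$P^{i-1}=A'P^{i}A+\bar A'P^0\bar A+Q,\qquad i=1,\dots,d,$$ $$P^d=(A-BK)'P^d(A-BK)+(\bar A-\bar BK)'P^0(\bar A-\bar BK)+Q,$$ then the closed-loop system $x_{k+1}=A_kx_k-B_kKx_k|_{k-d-1}$, with $A_k=A+w_k\bar A$ and $B_k=B+w_k\bar B$, is asymptotically mean-square stable.
   Context: Notation. A prime denotes transpose; $M>0$ ($M\ge0$) means symmetric positive definite (semi-definite). $\{w_k\}_{k\ge0}$ is a scalar white-noise sequence (independent random variables) with zero mean and $\mathsf E[w_kw_s]=\delta_{ks}$; $\mathcal F_k=\sigma(w_0,\dots,w_k)$ for $k\ge0$, and $\mathcal F_k$ is trivial for $k<0$. $x_k|_m=\mathsf E[x_k\mid\mathcal F_m]$. Closed loop and stability. The open-loop system is $x_{k+1}=A_kx_k+B_ku_{k-d}$, $k\ge0$, with deterministic initial data $x_0,u_{-d},\dots,u_{-1}$; the closed loop is obtained with $u_{k-d}=-Kx_k|_{k-d-1}$ for $k\ge d$. It is asymptotically mean-square stable if $\lim_{k\to\infty}\mathsf E[x_k'x_k]=0$ for all initial data $x_0,u_{-d},\dots,u_{-1}$.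 Exact observability. $(A-BK,\bar A-\bar BK\,|\,Q^{1/2})$ is exactly observable if for every initial time $j\ge d$ and every square-integrable $\mathcal F_{j-1}$-measurable $x_j$, the solution of $x_{k+1}=A_kx_k-B_kKx_k|_{k-d-1}$, $k\ge j$, with output $y_k=Q^{1/2}x_k$ satisfies: if $y_k=0$ a.s. on $j\le k\le N$ for every $N\ge j$, then $x_j=0$ a.s. *)

theory Defs
  imports "HOL-Probability.Probability"
begin

definition pos_semidef :: "real^'n^'n \<Rightarrow> bool" where
  "pos_semidef M \<longleftrightarrow> transpose M = M \<and> (\<forall>v. 0 \<le> v \<bullet> (M *v v))"

definition pos_def :: "real^'n^'n \<Rightarrow> bool" where
  "pos_def M \<longleftrightarrow> transpose M = M \<and> (\<forall>v. v \<noteq> 0 \<longrightarrow> 0 < v \<bullet> (M *v v))"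

(* The unique positive semidefinite square root; unspecified unless M is positive semidefinite. *)
definition psd_sqrt :: "real^'n^'n \<Rightarrow> real^'n^'n" where
  "psd_sqrt M = (THE R. pos_semidef R \<and> R ** R = M)"

definition white_noise :: "'a measure \<Rightarrow> (nat \<Rightarrow> 'a \<Rightarrow> real) \<Rightarrow> bool" where
  "white_noise M w \<longleftrightarrow>
     prob_space.indep_vars M (\<lambda>_. borel) w UNIV \<and>
     (\<forall>k. integrable M (w k) \<and> (\<integral>\<omega>. w k \<omega> \<partial>M) = 0) \<and>
     (\<forall>k s. integrable M (\<lambda>\<omega>. w k \<omega> * w s \<omega>) \<and>
            (\<integral>\<omega>. w k \<omega> * w s \<omega> \<partial>M) = (if k = s then 1 else 0))"

(* Integer time index: for negative k there are no generators, so the sigma-algebra is trivial. *)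
definition noise_filtration :: "'a measure \<Rightarrow> (nat \<Rightarrow> 'a \<Rightarrow> real) \<Rightarrow> int \<Rightarrow> 'a measure" where
  "noise_filtration M w k =
     sigma (space M) {w i -` S \<inter> space M | i S. int i \<le> k \<and> S \<in> sets borel}"

definition vec_cond_exp ::
  "'a measure \<Rightarrow> 'a measure \<Rightarrow> ('a \<Rightarrow> real^'n) \<Rightarrow> 'a \<Rightarrow> real^'n" where
  "vec_cond_exp M F X = (\<lambda>\<omega>. \<chi> i. real_cond_exp M F (\<lambda>\<omega>. X \<omega> $ i) \<omega>)"

(* C + w_k Cbar, with A_k and B_k as instances *)
definition noisy :: "(nat \<Rightarrow> 'a \<Rightarrow> real) \<Rightarrow> real^'n^'m \<Rightarrow> real^'n^'m \<Rightarrow> nat \<Rightarrow> 'a \<Rightarrow> real^'n^'m" where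
  "noisy w C Cbar k \<omega> = C + w k \<omega> *\<^sub>R Cbar"

definition feedback_step ::
  "'a measure \<Rightarrow> (nat \<Rightarrow> 'a \<Rightarrow> real) \<Rightarrow> nat \<Rightarrow> real^'n^'n \<Rightarrow> real^'n^'n \<Rightarrow> real^'m^'n \<Rightarrow> real^'m^'n \<Rightarrow>
   real^'n^'m \<Rightarrow> nat \<Rightarrow> ('a \<Rightarrow> real^'n) \<Rightarrow> 'a \<Rightarrow> real^'n" where
  "feedback_step M w d A Abar B Bbar K k X = (\<lambda>\<omega>.
     noisy w A Abar k \<omega> *v X \<omega> -
     noisy w B Bbar k \<omega> *v (K *v vec_cond_exp M (noise_filtration M w (int k - int d - 1)) X \<omega>))"

(* Only the values u (-d), ..., u (-1) of the initial input are used. *)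
definition closed_loop ::
  "'a measure \<Rightarrow> (nat \<Rightarrow> 'a \<Rightarrow> real) \<Rightarrow> nat \<Rightarrow> real^'n^'n \<Rightarrow> real^'n^'n \<Rightarrow> real^'m^'n \<Rightarrow> real^'m^'n \<Rightarrow>
   real^'n^'m \<Rightarrow> real^'n \<Rightarrow> (int \<Rightarrow> real^'m) \<Rightarrow> (nat \<Rightarrow> 'a \<Rightarrow> real^'n) \<Rightarrow> bool" where
  "closed_loop M w d A Abar B Bbar K x0 u x \<longleftrightarrow>
     x 0 = (\<lambda>_. x0) \<and>
     (\<forall>k<d. x (Suc k) =
        (\<lambda>\<omega>. noisy w A Abar k \<omega> *v x k \<omega> + noisy w B Bbar k \<omega> *v u (int k - int d))) \<and>
     (\<forall>k\<ge>d. x (Suc k) = feedback_step M w d A Abar B Bbar K k (x k))"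

(* Integrability is required because a Bochner integral that does not exist has value 0. *)
definition ms_stable ::
  "'a measure \<Rightarrow> (nat \<Rightarrow> 'a \<Rightarrow> real) \<Rightarrow> nat \<Rightarrow> real^'n^'n \<Rightarrow> real^'n^'n \<Rightarrow> real^'m^'n \<Rightarrow> real^'m^'n \<Rightarrow>
   real^'n^'m \<Rightarrow> bool" where
  "ms_stable M w d A Abar B Bbar K \<longleftrightarrow>
     (\<forall>x0 u x. closed_loop M w d A Abar B Bbar K x0 u x \<longrightarrow>
        (\<forall>k. integrable M (\<lambda>\<omega>. x k \<omega> \<bullet> x k \<omega>)) \<and>
        (\<lambda>k. \<integral>\<omega>. x k \<omega> \<bullet> x k \<omega> \<partial>M) \<longlonglongrightarrow> 0)"

(* The values of x before time j are irrelevant. *)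
definition exactly_observable ::
  "'a measure \<Rightarrow> (nat \<Rightarrow> 'a \<Rightarrow> real) \<Rightarrow> nat \<Rightarrow> real^'n^'n \<Rightarrow> real^'n^'n \<Rightarrow> real^'m^'n \<Rightarrow> real^'m^'n \<Rightarrow>
   real^'n^'m \<Rightarrow> real^'n^'n \<Rightarrow> bool" where
  "exactly_observable M w d A Abar B Bbar K C \<longleftrightarrow>
     (\<forall>j\<ge>d. \<forall>x :: nat \<Rightarrow> 'a \<Rightarrow> real^'n.
        x j \<in> borel_measurable (noise_filtration M w (int j - 1)) \<longrightarrow>
        integrable M (\<lambda>\<omega>. x j \<omega> \<bullet> x j \<omega>) \<longrightarrow>
        (\<forall>k\<ge>j. x (Suc k) = feedback_step M w d A Abar B Bbar K k (x k)) \<longrightarrow>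
        (\<forall>N\<ge>j. \<forall>k\<in>{j..N}. AE \<omega> in M. C *v x k \<omega> = 0) \<longrightarrow>
        (AE \<omega> in M. x j \<omega> = 0))"

end

theory Submission
  imports Defs
begin

text \<open>
  For \<open>k \<ge> d\<close> the state splits as \<open>x\<^sub>k = p\<^sub>k + (\<Sum>i<d. w\<^bsub>k-1-i\<^esub> \<psi>\<^sub>k\<^sub>,\<^sub>i)\<close> with \<open>p\<^sub>k\<close> the
  conditional expectation of \<open>x\<^sub>k\<close> given \<open>F\<^bsub>k-d-1\<^esub>\<close> and \<open>\<psi>\<^sub>k\<^sub>,\<^sub>i\<close> measurable for
  \<open>F\<^bsub>k-2-i\<^esub>\<close>; the summands are orthogonal in \<open>L\<^sup>2\<close>. For a tuple \<open>S\<close> of matrices put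
  \<open>J\<^sub>k S = E[p\<^sub>k' S\<^sup>d p\<^sub>k] + (\<Sum>i<d. E[\<psi>\<^sub>k\<^sub>,\<^sub>i' S\<^sup>i \<psi>\<^sub>k\<^sub>,\<^sub>i])\<close>. One step of the dynamics gives
  \<open>J\<^bsub>k+1\<^esub> S + E[x\<^sub>k' Q x\<^sub>k] = J\<^sub>k (T S)\<close>, where \<open>T\<close> is the right-hand side of the coupled
  equations. Hence the output energy over a window of length \<open>N\<close> is \<open>J\<^sub>k (T\<^sup>N 0) \<le> J\<^sub>k P\<close>, so
  \<open>E[x\<^sub>k' Q x\<^sub>k]\<close> is summable.

  Exact observability, tested on the states \<open>v\<close> and \<open>w\<^sub>l v\<close> with \<open>l < d\<close> at time \<open>d\<close>, together with
  compactness of the unit sphere makes every matrix of \<open>T\<^sup>N 0\<close> at least \<open>g > 0\<close> for some \<open>N\<close>. Then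
  \<open>g E[x\<^sub>k' x\<^sub>k]\<close> is at most the output energy over the window starting at \<open>k\<close>, which tends to \<open>0\<close>.
\<close>

subsection \<open>Positive semidefinite square roots\<close>

lemma symmetric_matrix_inner:
  fixes M :: "real^'n^'n"
  assumes "transpose M = M"
  shows "(M *v x) \<bullet> y = x \<bullet> (M *v y)"
  by (metis assms dot_lmul_matrix transpose_matrix_vector)

text \<open>A maximizer of the Rayleigh quotient over the compact unit sphere of the invariant
  subspace \<open>U\<close> is an eigenvector, and the maximum is its eigenvalue.\<close>

lemma self_adjoint_eigenvector:
  fixes f :: "'a::euclidean_space \<Rightarrow> 'a"
  assumes "linear f" and sym: "\<And>x y. f x \<bullet> y = x \<bullet> f y"
    and U: "subspace U" "f ` U \<subseteq> U" "U \<noteq> {0}"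
  obtains x l where "x \<in> U" "norm x = 1" "f x = l *\<^sub>R x"
proof -
  interpret f: linear f by fact
  obtain u where u: "u \<in> U" "u \<noteq> 0"
    using U subspace_0 by blast
  then have "u /\<^sub>R norm u \<in> U \<inter> sphere 0 1"
    using U(1) by (simp add: subspace_scale)
  moreover have "compact (U \<inter> sphere 0 1)"
    by (simp add: closed_Int_compact closed_subspace U(1))
  moreover have "continuous_on (U \<inter> sphere 0 1) (\<lambda>x. f x \<bullet> x)"
    by (intro continuous_intros linear_continuous_on linear_conv_bounded_linear[THEN iffD1] \<open>linear f\<close>)
  ultimately obtain x where x: "x \<in> U" "norm x = 1"
    and max: "\<And>y. y \<in> U \<inter> sphere 0 1 \<Longrightarrow> f y \<bullet> y \<le> f x \<bullet> x"
    using continuous_attains_sup[of "U \<inter> sphere 0 1" "\<lambda>x. f x \<bullet> x"] by (metis IntD1 IntD2 emptyE mem_sphere_0)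
  define l where "l = f x \<bullet> x"
  have le: "0 \<le> l * (y \<bullet> y) - f y \<bullet> y" if "y \<in> U" for y
  proof (cases "y = 0")
    case False
    then have "y /\<^sub>R norm y \<in> U \<inter> sphere 0 1"
      using U(1) that by (simp add: subspace_scale)
    from max[OF this] have "(f y \<bullet> y) / (norm y)\<^sup>2 \<le> l"
      by (simp add: l_def f.scale power2_eq_square divide_inverse mult_ac)
    then show ?thesis
      using False by (simp add: power2_norm_eq_inner divide_le_eq)
  qed (simp add: f.zero)
  define z where "z = l *\<^sub>R x - f x"
  have zU: "z \<in> U"
    using U x by (auto simp: z_def intro!: subspace_diff subspace_scale)
  \<comment> \<open>The form \<open>l |y|\<^sup>2 - f y \<bullet> y\<close> is nonnegative on \<open>U\<close> and vanishes at \<open>x\<close>, so its gradient \<open>2 z\<close> there vanishes.\<close>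
  have quad: "0 \<le> 2 * t * (z \<bullet> z) + t\<^sup>2 * (l * (z \<bullet> z) - f z \<bullet> z)" for t
  proof -
    have "x + t *\<^sub>R z \<in> U"
      using U(1) x zU by (intro subspace_add subspace_scale)
    from le[OF this] have "0 \<le> l * ((x + t *\<^sub>R z) \<bullet> (x + t *\<^sub>R z)) - f (x + t *\<^sub>R z) \<bullet> (x + t *\<^sub>R z)" .
    also have "\<dots> = (l * (x \<bullet> x) - f x \<bullet> x) + 2 * t * (l * (x \<bullet> z) - f x \<bullet> z) + t\<^sup>2 * (l * (z \<bullet> z) - f z \<bullet> z)"
      using sym[of z x] by (simp add: f.add f.scale inner_add power2_eq_square inner_commute algebra_simps)
    also have "l * (x \<bullet> x) - f x \<bullet> x = 0"
      using x by (simp add: l_def dot_square_norm)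
    also have "l * (x \<bullet> z) - f x \<bullet> z = z \<bullet> z"
      by (simp add: z_def inner_diff inner_commute algebra_simps)
    finally show ?thesis by simp
  qed
  have "z \<bullet> z = 0"
  proof (rule ccontr)
    assume nz: "z \<bullet> z \<noteq> 0"
    define a where "a = z \<bullet> z"
    define c where "c = l * (z \<bullet> z) - f z \<bullet> z"
    have "a > 0" "c \<ge> 0"
      using nz inner_ge_zero[of z] le[OF zU] unfolding a_def c_def by linarith+
    have "0 \<le> 2 * t * a + t\<^sup>2 * c" for t
      using quad by (simp add: a_def c_def)
    \<comment> \<open>This \<open>t\<close> makes the linear term outweigh the quadratic one; the
      denominator \<open>c + 1\<close> stays positive when \<open>c = 0\<close>.\<close>
    from this[of "- a / (c + 1)"] have "2 * a * a / (c + 1) \<le> a * a * c / (c + 1)\<^sup>2"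
      by (simp add: power_divide power2_eq_square)
    then have "2 * a * a * (c + 1) \<le> a * a * c"
      using \<open>c \<ge> 0\<close> by (simp add: divide_simps power2_eq_square)
    moreover have "a * a * c \<ge> 0" "a * a > 0" using \<open>a > 0\<close> \<open>c \<ge> 0\<close> by auto
    ultimately show False by (simp add: algebra_simps)
  qed
  then show thesis
    using that[of x l] x by (simp add: z_def)
qed

text \<open>Split off a unit eigenvector and recurse on its orthogonal complement in
  \<open>U\<close>, which is invariant by self-adjointness. Allowing any invariant \<open>U\<close>
  makes this induction on dimension possible.\<close>

lemma self_adjoint_eigenbasis:
  fixes f :: "'a::euclidean_space \<Rightarrow> 'a"
  assumes "linear f" and sym: "\<And>x y. f x \<bullet> y = x \<bullet> f y"
    and "subspace U" "f ` U \<subseteq> U"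
  shows "\<exists>B. finite B \<and> pairwise orthogonal B \<and> span B = U \<and> (\<forall>b\<in>B. norm b = 1 \<and> (\<exists>l. f b = l *\<^sub>R b))"
  using assms(3,4)
proof (induction "dim U" arbitrary: U rule: less_induct)
  case less
  show ?case
  proof (cases "U = {0}")
    case True
    then show ?thesis by (intro exI[of _ "{}"]) auto
  next
    case False
    then obtain x l where x: "x \<in> U" "norm x = 1" "f x = l *\<^sub>R x"
      using self_adjoint_eigenvector[OF \<open>linear f\<close> sym less.prems] by blast
    define V where "V = U \<inter> {y. x \<bullet> y = 0}"
    have V: "subspace V"
      unfolding V_def by (intro subspace_inter less.prems subspace_hyperplane)
    have "x \<notin> V" using x by (auto simp: V_def dot_square_norm)
    moreover have "V \<subseteq> U" by (simp add: V_def)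
    ultimately have "V \<subset> U" using x(1) by blast
    then have "dim V < dim U"
      using V less.prems(1) by (metis dim_psubset span_eq_iff)
    moreover have "f ` V \<subseteq> V"
      using less.prems(2) x(3) by (auto simp: V_def simp flip: sym)
    ultimately obtain B where B: "finite B" "pairwise orthogonal B" "span B = V"
      "\<And>b. b \<in> B \<Longrightarrow> norm b = 1 \<and> (\<exists>l. f b = l *\<^sub>R b)"
      using less.hyps V by metis
    have "B \<subseteq> V" using B(3) span_superset by blast
    have "span (insert x B) = U"
    proof
      show "span (insert x B) \<subseteq> U"
        using \<open>B \<subseteq> V\<close> x less.prems(1) by (intro span_minimal) (auto simp: V_def)
      show "U \<subseteq> span (insert x B)"
      proof
        fix y assume "y \<in> U"
        then have "y - (x \<bullet> y) *\<^sub>R x \<in> V"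
          using x less.prems(1) by (auto simp: V_def inner_diff dot_square_norm subspace_diff subspace_scale)
        then show "y \<in> span (insert x B)"
          unfolding span_insert B(3) by blast
      qed
    qed
    moreover have "pairwise orthogonal (insert x B)"
      using B(2) \<open>B \<subseteq> V\<close> by (auto simp: pairwise_insert V_def orthogonal_def inner_commute)
    ultimately show ?thesis
      using B x by (intro exI[of _ "insert x B"]) auto
  qed
qed

lemma psd_sqrt_exists:
  fixes Q :: "real^'n^'n"
  assumes "pos_semidef Q"
  shows "\<exists>R. pos_semidef R \<and> R ** R = Q"
proof -
  have Q: "transpose Q = Q" "\<And>v. 0 \<le> v \<bullet> (Q *v v)"
    using assms by (auto simp: pos_semidef_def)
  obtain B where B: "finite B" "pairwise orthogonal B" "span B = (UNIV :: (real^'n) set)"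
    and eig: "\<And>b. b \<in> B \<Longrightarrow> norm b = 1 \<and> (\<exists>l. Q *v b = l *\<^sub>R b)"
    using self_adjoint_eigenbasis[of "(*v) Q" UNIV] Q(1) by (auto simp: symmetric_matrix_inner)
  \<comment> \<open>On a unit eigenvector this form is the eigenvalue itself, so nonnegativity is
    immediate.\<close>
  define l where "l b = b \<bullet> (Q *v b)" for b
  have l: "Q *v b = l b *\<^sub>R b" "0 \<le> l b" if "b \<in> B" for b
    using eig[OF that] Q(2) by (auto simp: l_def dot_square_norm)
  define g where "g v = (\<Sum>b\<in>B. (sqrt (l b) * (b \<bullet> v)) *\<^sub>R b)" for v
  have lin: "linear g"
    by (intro linearI) (simp_all add: g_def inner_add algebra_simps sum.distrib scaleR_sum_right)
  have R: "matrix g *v v = g v" for v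
    using lin by simp
  have g_inner: "x \<bullet> g y = (\<Sum>b\<in>B. sqrt (l b) * (b \<bullet> x) * (b \<bullet> y))" for x y
    by (simp add: g_def inner_sum_right inner_commute mult_ac)
  have gB: "g b = sqrt (l b) *\<^sub>R b" if "b \<in> B" for b
  proof -
    have "g b = (\<Sum>c\<in>B. if c = b then sqrt (l b) *\<^sub>R b else 0)"
      unfolding g_def using B(2) eig[OF that] that
      by (intro sum.cong) (auto simp: pairwise_def orthogonal_def dot_square_norm)
    then show ?thesis using B(1) that by simp
  qed
  have "g (g v) = Q *v v" for v
  proof (rule linear_eq_on_span[of "\<lambda>v. g (g v)" "(*v) Q" B v])
    show "linear (\<lambda>v. g (g v))" using lin linear_compose[OF lin lin] by (simp add: o_def)
    show "g (g b) = Q *v b" if "b \<in> B" for b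
      using that lin l by (simp add: gB linear_cmul)
  qed (use B in auto)
  then have "matrix g ** matrix g = Q"
    by (simp add: matrix_eq R flip: matrix_vector_mul_assoc)
  moreover have "transpose (matrix g) = matrix g"
  proof -
    have "(transpose (matrix g) *v x) \<bullet> y = (matrix g *v x) \<bullet> y" for x y
    proof -
      have "(transpose (matrix g) *v x) \<bullet> y = x \<bullet> g y"
        by (metis R dot_lmul_matrix transpose_matrix_vector)
      also have "\<dots> = y \<bullet> g x" by (simp add: g_inner mult_ac)
      finally show ?thesis by (simp add: R inner_commute)
    qed
    then show ?thesis by (metis matrix_eq vector_eq_rdot)
  qed
  moreover have "0 \<le> v \<bullet> (matrix g *v v)" for v
    unfolding R g_inner by (intro sum_nonneg) (use l in \<open>auto simp: mult.assoc\<close>)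
  ultimately show ?thesis
    by (auto simp: pos_semidef_def)
qed

text \<open>The eigenvectors of \<open>R - S\<close> span. If \<open>b\<close> is a unit one with
  eigenvalue \<open>l\<close>, equal squares give
  \<open>l * (b \<bullet> (R *v b + S *v b)) = 0\<close>. Either \<open>l = 0\<close>, or both
  nonnegative forms vanish at \<open>b\<close> and so does their difference, which is
  \<open>l\<close>.\<close>

lemma psd_sqrt_unique:
  fixes R S :: "real^'n^'n"
  assumes "pos_semidef R" "pos_semidef S" "R ** R = S ** S"
  shows "R = S"
proof -
  have R: "transpose R = R" "\<And>v. 0 \<le> v \<bullet> (R *v v)" and S: "transpose S = S" "\<And>v. 0 \<le> v \<bullet> (S *v v)"
    using assms by (auto simp: pos_semidef_def)
  note symm = symmetric_matrix_inner[OF R(1)] symmetric_matrix_inner[OF S(1)]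
  obtain B where B: "span B = (UNIV :: (real^'n) set)"
    and eig: "\<And>b. b \<in> B \<Longrightarrow> norm b = 1 \<and> (\<exists>l. (R - S) *v b = l *\<^sub>R b)"
    using self_adjoint_eigenbasis[of "(*v) (R - S)" UNIV]
    by (auto simp: matrix_vector_mult_diff_rdistrib inner_diff symm)
  have "(R - S) *v b = 0" if "b \<in> B" for b
  proof -
    obtain l where l: "(R - S) *v b = l *\<^sub>R b" and b: "b \<bullet> b = 1"
      using eig[OF \<open>b \<in> B\<close>] by (auto simp: dot_square_norm)
    have "l * (b \<bullet> (R *v b + S *v b)) = ((R - S) *v b) \<bullet> (R *v b + S *v b)"
      by (simp add: l)
    also have "\<dots> = b \<bullet> ((R ** R) *v b) - b \<bullet> ((S ** S) *v b)"
      by (simp add: matrix_vector_mult_diff_rdistrib inner_diff inner_add symm inner_commute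
          flip: matrix_vector_mul_assoc)
    finally have "l = 0 \<or> b \<bullet> (R *v b) + b \<bullet> (S *v b) = 0"
      by (simp add: assms(3) inner_add)
    moreover have "l = b \<bullet> (R *v b) - b \<bullet> (S *v b)"
      using arg_cong[OF l, of "(\<bullet>) b"] b by (simp add: matrix_vector_mult_diff_rdistrib inner_diff)
    ultimately have "l = 0" using R(2)[of b] S(2)[of b] by linarith
    then show ?thesis using l by simp
  qed
  then have "(R - S) *v v = 0" for v
    using linear_eq_on_span[OF matrix_vector_mul_linear linear_zero, of B] B by blast
  then show ?thesis
    by (simp add: matrix_eq matrix_vector_mult_diff_rdistrib)
qed

lemma psd_sqrt_square:
  fixes Q :: "real^'n^'n"
  assumes "pos_semidef Q"
  shows "pos_semidef (psd_sqrt Q)" "psd_sqrt Q ** psd_sqrt Q = Q"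
proof -
  have "\<exists>!R. pos_semidef R \<and> R ** R = Q"
    using psd_sqrt_exists[OF assms] psd_sqrt_unique by metis
  from theI'[OF this] show "pos_semidef (psd_sqrt Q)" "psd_sqrt Q ** psd_sqrt Q = Q"
    by (auto simp: psd_sqrt_def)
qed

text \<open>The form \<open>v \<bullet> (Q *v v)\<close> is the squared norm of
  \<open>psd_sqrt Q *v v\<close>. This turns zero output energy into zero output.\<close>

lemma psd_sqrt_kernel:
  fixes Q :: "real^'n^'n"
  assumes "pos_semidef Q" "v \<bullet> (Q *v v) = 0"
  shows "psd_sqrt Q *v v = 0"
proof -
  have "(psd_sqrt Q *v v) \<bullet> (psd_sqrt Q *v v) = v \<bullet> ((psd_sqrt Q ** psd_sqrt Q) *v v)"
    using psd_sqrt_square(1)[OF assms(1)]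
    by (simp add: symmetric_matrix_inner pos_semidef_def flip: matrix_vector_mul_assoc)
  then show ?thesis
    using psd_sqrt_square(2)[OF assms(1)] assms(2) by simp
qed

lemma inner_transpose:
  fixes C :: "real^'n^'m"
  shows "v \<bullet> (transpose C *v u) = (C *v v) \<bullet> u"
  by (metis dot_lmul_matrix vector_transpose_matrix)

lemma form_congruence:
  fixes C :: "real^'k^'l"
  shows "v \<bullet> ((transpose C ** S ** C) *v v) = (C *v v) \<bullet> (S *v (C *v v))"
  unfolding matrix_vector_mul_assoc[symmetric] inner_transpose ..

subsection \<open>Square-integrable adapted vectors\<close>

locale white_noise_space = prob_space M for M :: "'a measure" +
  fixes w :: "nat \<Rightarrow> 'a \<Rightarrow> real"
  assumes white_noise: "white_noise M w"
begin

abbreviation "F \<equiv> noise_filtration M w"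

section \<open>The noise filtration and independence of the past\<close>

lemma noise_measurable [measurable]: "w i \<in> borel_measurable M"
  using white_noise indep_vars_def2 by (auto simp: white_noise_def)

lemma space_F [simp]: "space (F k) = space M"
  by (auto simp: noise_filtration_def intro!: space_measure_of)

lemma sets_F:
  "sets (F k) = sigma_sets (space M) {w i -` S \<inter> space M | i S. int i \<le> k \<and> S \<in> sets borel}"
  unfolding noise_filtration_def by (intro sets_measure_of) auto

lemma subalgebra_F: "subalgebra M (F k)"
proof -
  have "sets (F k) \<subseteq> sets M"
    unfolding sets_F by (intro sets.sigma_sets_subset) auto
  then show ?thesis by (simp add: subalgebra_def)
qed

lemma subalgebra_F_mono:
  assumes "k \<le> l"
  shows "subalgebra (F l) (F k)"
proof -
  have "w i -` S \<inter> space M \<in> {w i -` S \<inter> space M | i S. int i \<le> l \<and> S \<in> sets borel}"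
    if "int i \<le> k" "S \<in> sets borel" for i S
    using that assms by (intro CollectI exI[of _ i] exI[of _ S]) auto
  then show ?thesis
    unfolding subalgebra_def sets_F space_F by (intro conjI refl sigma_sets_mono') blast
qed

lemma noise_measurable_F: "int i \<le> k \<Longrightarrow> w i \<in> borel_measurable (F k)"
  by (intro measurableI) (auto simp: sets_F)

text \<open>Group the independent noises into the blocks \<open>{l}\<close> and
  \<open>{..<l}\<close>; the sigma-algebras they generate are independent, and \<open>g\<close> is
  measurable for the second.\<close>

lemma noise_indep_past:
  assumes g: "g \<in> borel_measurable (F (int l - 1))"
  shows "indep_var borel (w l) borel g"
proof -
  define E where "E i = {w i -` A \<inter> space M | A. A \<in> sets borel}" for i
  define I where "I = case_bool {l} {..<l}"
  have "indep_sets E UNIV"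
    using white_noise unfolding white_noise_def indep_vars_def2 E_def by blast
  then have "indep_sets (\<lambda>j. sigma_sets (space M) (\<Union>i\<in>I j. E i)) UNIV"
  proof (intro indep_sets_collect_sigma)
    show "indep_sets E (\<Union> (range I))"
      by (rule indep_sets_mono_index[OF _ \<open>indep_sets E UNIV\<close>]) auto
    show "disjoint_family_on I UNIV"
      by (auto simp: disjoint_family_on_def I_def split: bool.splits)
    show "Int_stable (E i)" for i
    proof (rule Int_stableI)
      fix a b assume "a \<in> E i" "b \<in> E i"
      then obtain A B where "A \<in> sets borel" "B \<in> sets borel" "a = w i -` A \<inter> space M" "b = w i -` B \<inter> space M"
        by (auto simp: E_def)
      then show "a \<inter> b \<in> E i"
        unfolding E_def by (intro CollectI exI[of _ "A \<inter> B"]) auto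
    qed
  qed
  \<comment> \<open>The integer bound \<open>int i \<le> int l - 1\<close> is the strict bound
    \<open>i < l\<close>, also for \<open>l = 0\<close>, where the past is trivial.\<close>
  moreover have "(\<lambda>j. sigma_sets (space M) (\<Union>i\<in>I j. E i))
      = case_bool (sigma_sets (space M) (E l)) (sets (F (int l - 1)))"
  proof
    fix j
    have "{w i -` S \<inter> space M | i S. int i \<le> int l - 1 \<and> S \<in> sets borel} = (\<Union>i<l. E i)"
      by (auto simp: E_def)
    then show "sigma_sets (space M) (\<Union>i\<in>I j. E i)
      = (case j of True \<Rightarrow> sigma_sets (space M) (E l) | False \<Rightarrow> sets (F (int l - 1)))"
      by (auto simp: I_def sets_F split: bool.splits)
  qed
  ultimately have ind: "indep_sets (case_bool (sigma_sets (space M) (E l)) (sets (F (int l - 1)))) UNIV"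
    by simp
  have "indep_set (sigma_sets (space M) (E l)) (sigma_sets (space M) {g -` A \<inter> space M |A. A \<in> sets borel})"
    unfolding indep_set_def
  proof (rule indep_sets_mono_sets[OF ind])
    have "{g -` A \<inter> space M |A. A \<in> sets borel} \<subseteq> sets (F (int l - 1))"
      using measurable_sets[OF g] by auto
    from sets.sigma_sets_subset[OF this]
    have "sigma_sets (space M) {g -` A \<inter> space M |A. A \<in> sets borel} \<subseteq> sets (F (int l - 1))"
      by simp
    then show "(case j of True \<Rightarrow> sigma_sets (space M) (E l)
        | False \<Rightarrow> sigma_sets (space M) {g -` A \<inter> space M |A. A \<in> sets borel})
      \<subseteq> (case j of True \<Rightarrow> sigma_sets (space M) (E l) | False \<Rightarrow> sets (F (int l - 1)))" for j
      by (auto split: bool.splits)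
  qed
  moreover have "g \<in> borel_measurable M"
    using g by (rule measurable_from_subalg[OF subalgebra_F])
  ultimately show ?thesis
    by (simp add: indep_var_eq E_def)
qed

text \<open>Independence factorizes both expectations, and the noise has mean 0 and second moment
  1.\<close>

lemma noise_mult_past:
  assumes g: "g \<in> borel_measurable (F (int l - 1))" and int: "integrable M g"
  shows "integrable M (\<lambda>\<omega>. w l \<omega> * g \<omega>)" "(\<integral>\<omega>. w l \<omega> * g \<omega> \<partial>M) = 0"
    and "integrable M (\<lambda>\<omega>. (w l \<omega>)\<^sup>2 * g \<omega>)" "(\<integral>\<omega>. (w l \<omega>)\<^sup>2 * g \<omega> \<partial>M) = (\<integral>\<omega>. g \<omega> \<partial>M)"
proof -
  have w: "integrable M (w l)" "(\<integral>\<omega>. w l \<omega> \<partial>M) = 0"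
    "integrable M (\<lambda>\<omega>. (w l \<omega>)\<^sup>2)" "(\<integral>\<omega>. (w l \<omega>)\<^sup>2 \<partial>M) = 1"
    using white_noise by (auto simp: white_noise_def power2_eq_square)
  note ind = noise_indep_past[OF g]
  have ind2: "indep_var borel (\<lambda>\<omega>. (w l \<omega>)\<^sup>2) borel g"
    using indep_var_compose[OF ind, of "\<lambda>x. x\<^sup>2" borel id borel] by (simp add: o_def id_def)
  show "integrable M (\<lambda>\<omega>. w l \<omega> * g \<omega>)" "integrable M (\<lambda>\<omega>. (w l \<omega>)\<^sup>2 * g \<omega>)"
    using indep_var_integrable[OF ind w(1) int] indep_var_integrable[OF ind2 w(3) int] by simp_all
  show "(\<integral>\<omega>. w l \<omega> * g \<omega> \<partial>M) = 0" "(\<integral>\<omega>. (w l \<omega>)\<^sup>2 * g \<omega> \<partial>M) = (\<integral>\<omega>. g \<omega> \<partial>M)"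
    using indep_var_lebesgue_integral[OF ind w(1) int] indep_var_lebesgue_integral[OF ind2 w(3) int] w
    by simp_all
qed

text \<open>Adaptedness and square integrability are bundled. The integer index admits negative
  times, where the sigma-algebra is trivial.\<close>

definition L2 :: "int \<Rightarrow> ('a \<Rightarrow> real^'n) \<Rightarrow> bool" where
  "L2 k X \<longleftrightarrow> X \<in> borel_measurable (F k) \<and> integrable M (\<lambda>\<omega>. X \<omega> \<bullet> X \<omega>)"

lemma L2_measurable: "L2 k X \<Longrightarrow> X \<in> borel_measurable M"
  using measurable_from_subalg[OF subalgebra_F] by (auto simp: L2_def)

lemma L2_mono: "L2 k X \<Longrightarrow> k \<le> l \<Longrightarrow> L2 l X"
  using measurable_from_subalg[OF subalgebra_F_mono] by (auto simp: L2_def)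

lemma L2_const: "L2 k (\<lambda>_. c)"
  by (simp add: L2_def)

lemma L2_inner:
  assumes "L2 k X" "L2 l Y"
  shows "integrable M (\<lambda>\<omega>. X \<omega> \<bullet> Y \<omega>)"
proof (rule Bochner_Integration.integrable_bound)
  show "integrable M (\<lambda>\<omega>. X \<omega> \<bullet> X \<omega> + Y \<omega> \<bullet> Y \<omega>)"
    using assms by (auto simp: L2_def)
  show "(\<lambda>\<omega>. X \<omega> \<bullet> Y \<omega>) \<in> borel_measurable M"
    using L2_measurable assms by (intro borel_measurable_inner) auto
  have "\<bar>x \<bullet> y\<bar> \<le> x \<bullet> x + y \<bullet> y" for x y :: "real^'c"
    using inner_ge_zero[of "x - y"] inner_ge_zero[of "x + y"] inner_ge_zero[of x] inner_ge_zero[of y]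
    by (simp add: inner_diff inner_add inner_commute abs_le_iff)
  then show "AE \<omega> in M. norm (X \<omega> \<bullet> Y \<omega>) \<le> norm (X \<omega> \<bullet> X \<omega> + Y \<omega> \<bullet> Y \<omega>)"
    by (intro AE_I2) (auto intro: order_trans)
qed

lemma L2_add:
  assumes "L2 k X" "L2 k Y"
  shows "L2 k (\<lambda>\<omega>. X \<omega> + Y \<omega>)"
proof -
  have "integrable M (\<lambda>\<omega>. X \<omega> \<bullet> X \<omega> + 2 * (X \<omega> \<bullet> Y \<omega>) + Y \<omega> \<bullet> Y \<omega>)"
    using assms L2_inner[OF assms] by (auto simp: L2_def)
  then have "integrable M (\<lambda>\<omega>. (X \<omega> + Y \<omega>) \<bullet> (X \<omega> + Y \<omega>))"
    by (rule back_subst[where P="integrable M"]) (auto simp: inner_add inner_commute)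
  then show ?thesis using assms by (auto simp: L2_def)
qed

lemma matrix_mult_measurable:
  fixes A :: "real^'n^'m"
  assumes "X \<in> borel_measurable N"
  shows "(\<lambda>\<omega>. A *v X \<omega>) \<in> borel_measurable N"
  using measurable_compose[OF assms borel_measurable_continuous_onI, of "(*v) A"]
  by (simp add: continuous_intros linear_continuous_on linear_conv_bounded_linear[THEN iffD1])

lemma L2_matrix:
  fixes A :: "real^'n^'m"
  assumes "L2 k X"
  shows "L2 k (\<lambda>\<omega>. A *v X \<omega>)"
proof -
  have meas: "(\<lambda>\<omega>. A *v X \<omega>) \<in> borel_measurable (F k)"
    using assms by (intro matrix_mult_measurable) (auto simp: L2_def)
  obtain C where C: "\<And>x. norm (A *v x) \<le> norm x * C"
    using bounded_linear.bounded[OF matrix_vector_mul_bounded_linear, of A] by blast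
  have "integrable M (\<lambda>\<omega>. (A *v X \<omega>) \<bullet> (A *v X \<omega>))"
  proof (rule Bochner_Integration.integrable_bound)
    show "integrable M (\<lambda>\<omega>. C\<^sup>2 * (X \<omega> \<bullet> X \<omega>))"
      using assms by (auto simp: L2_def)
    show "(\<lambda>\<omega>. (A *v X \<omega>) \<bullet> (A *v X \<omega>)) \<in> borel_measurable M"
      using measurable_from_subalg[OF subalgebra_F meas] by measurable
    have "(A *v x) \<bullet> (A *v x) \<le> C\<^sup>2 * (x \<bullet> x)" for x
      using power_mono[OF C norm_ge_zero, of x 2] by (simp add: dot_square_norm power_mult_distrib mult.commute)
    then show "AE \<omega> in M. norm ((A *v X \<omega>) \<bullet> (A *v X \<omega>)) \<le> norm (C\<^sup>2 * (X \<omega> \<bullet> X \<omega>))"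
      by (auto simp: abs_mult)
  qed
  with meas show ?thesis by (simp add: L2_def)
qed

text \<open>A product of square-integrable variables need not be square integrable; here
  independence of \<open>w l\<close> from the past makes it so.\<close>

lemma L2_noise:
  assumes "L2 (int l - 1) X"
  shows "L2 (int l) (\<lambda>\<omega>. w l \<omega> *\<^sub>R X \<omega>)"
proof -
  have [measurable]: "X \<in> borel_measurable (F (int l))"
    using L2_mono[OF assms] by (auto simp: L2_def)
  have [measurable]: "w l \<in> borel_measurable (F (int l))"
    by (simp add: noise_measurable_F)
  have "(\<lambda>\<omega>. X \<omega> \<bullet> X \<omega>) \<in> borel_measurable (F (int l - 1))"
    using assms by (intro borel_measurable_inner) (auto simp: L2_def)
  from noise_mult_past(3)[OF this] assms show ?thesis
    by (auto simp: L2_def power2_eq_square mult_ac)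
qed

text \<open>The cross terms are \<open>w l\<close> times a past variable and average to 0, while the
  factor \<open>(w l)\<^sup>2\<close> averages to 1.\<close>

lemma pythagoras:
  fixes S :: "real^'n^'n"
  assumes "L2 (int l - 1) Y" "L2 (int l - 1) X"
  shows "(\<integral>\<omega>. (Y \<omega> + w l \<omega> *\<^sub>R X \<omega>) \<bullet> (S *v (Y \<omega> + w l \<omega> *\<^sub>R X \<omega>)) \<partial>M)
    = (\<integral>\<omega>. Y \<omega> \<bullet> (S *v Y \<omega>) \<partial>M) + (\<integral>\<omega>. X \<omega> \<bullet> (S *v X \<omega>) \<partial>M)"
proof -
  define g where "g \<omega> = Y \<omega> \<bullet> (S *v X \<omega>) + X \<omega> \<bullet> (S *v Y \<omega>)" for \<omega>
  define h where "h \<omega> = X \<omega> \<bullet> (S *v X \<omega>)" for \<omega>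
  note SX = L2_matrix[OF assms(2), of S] and SY = L2_matrix[OF assms(1), of S]
  have g: "g \<in> borel_measurable (F (int l - 1))" "integrable M g"
    using assms SX SY unfolding g_def
    by (auto simp: L2_def intro!: Bochner_Integration.integrable_add L2_inner[OF assms(1) SX] L2_inner[OF assms(2) SY])
  have h: "h \<in> borel_measurable (F (int l - 1))" "integrable M h"
    using assms SX unfolding h_def by (auto simp: L2_def intro!: L2_inner[OF assms(2) SX])
  have "(\<lambda>\<omega>. (Y \<omega> + w l \<omega> *\<^sub>R X \<omega>) \<bullet> (S *v (Y \<omega> + w l \<omega> *\<^sub>R X \<omega>)))
    = (\<lambda>\<omega>. Y \<omega> \<bullet> (S *v Y \<omega>) + w l \<omega> * g \<omega> + (w l \<omega>)\<^sup>2 * h \<omega>)"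
    by (auto simp: g_def h_def matrix_vector_right_distrib matrix_vector_mult_scaleR inner_add power2_eq_square algebra_simps)
  then show ?thesis
    using noise_mult_past(1,2)[OF g] noise_mult_past(3,4)[OF h] L2_inner[OF assms(1) SY]
    by (simp add: h_def)
qed

lemma L2_component:
  assumes "L2 k X"
  shows "(\<lambda>\<omega>. X \<omega> $ j) \<in> borel_measurable (F k)" "integrable M (\<lambda>\<omega>. X \<omega> $ j)"
proof -
  have eq: "(\<lambda>\<omega>. X \<omega> $ j) = (\<lambda>\<omega>. X \<omega> \<bullet> axis j 1)"
    by (simp add: inner_axis)
  show "(\<lambda>\<omega>. X \<omega> $ j) \<in> borel_measurable (F k)"
    using assms unfolding eq by (auto simp: L2_def)
  show "integrable M (\<lambda>\<omega>. X \<omega> $ j)"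
    unfolding eq using assms L2_const by (rule L2_inner)
qed

lemma L2_AE_cong:
  assumes "L2 k X" "Y \<in> borel_measurable (F k)" "AE \<omega> in M. Y \<omega> = X \<omega>"
  shows "L2 k Y"
proof -
  have [measurable]: "Y \<in> borel_measurable M" "X \<in> borel_measurable M"
    using assms measurable_from_subalg[OF subalgebra_F] L2_measurable by blast+
  have "integrable M (\<lambda>\<omega>. Y \<omega> \<bullet> Y \<omega>) \<longleftrightarrow> integrable M (\<lambda>\<omega>. X \<omega> \<bullet> X \<omega>)"
    using assms(3) by (intro integrable_cong_AE) auto
  then show ?thesis using assms by (simp add: L2_def)
qed

lemma vec_cond_exp_measurable:
  "vec_cond_exp M G X \<in> borel_measurable G"
  unfolding vec_cond_exp_def
  by (subst borel_measurable_euclidean_space) (auto simp: Basis_vec_def inner_axis)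

section \<open>Expected quadratic forms\<close>

definition E_quad :: "real^'n^'n \<Rightarrow> ('a \<Rightarrow> real^'n) \<Rightarrow> real" where
  "E_quad S X = (\<integral>\<omega>. X \<omega> \<bullet> (S *v X \<omega>) \<partial>M)"

lemma E_quad_congruence:
  fixes C :: "real^'n^'m"
  shows "E_quad (transpose C ** S ** C) X = E_quad S (\<lambda>\<omega>. C *v X \<omega>)"
  by (simp add: E_quad_def form_congruence)

lemma E_quad_add:
  assumes "L2 k X"
  shows "E_quad (S + T) X = E_quad S X + E_quad T X"
  using L2_inner[OF assms L2_matrix[OF assms, of S]] L2_inner[OF assms L2_matrix[OF assms, of T]]
  by (simp add: E_quad_def matrix_vector_mult_add_rdistrib inner_add)

lemma E_quad_mono:
  assumes "L2 k X" "\<And>v. v \<bullet> (S *v v) \<le> v \<bullet> (T *v v)"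
  shows "E_quad S X \<le> E_quad T X"
  unfolding E_quad_def using assms(2)
  by (intro integral_mono L2_inner[OF assms(1) L2_matrix[OF assms(1)]]) auto

lemma E_quad_const: "E_quad S (\<lambda>_. v) = v \<bullet> (S *v v)"
  by (simp add: E_quad_def prob_space)

lemma E_quad_cong_AE:
  assumes "L2 k X" "L2 l Y" "AE \<omega> in M. X \<omega> = Y \<omega>"
  shows "E_quad S X = E_quad S Y"
proof -
  have "(\<lambda>\<omega>. X \<omega> \<bullet> (S *v X \<omega>)) \<in> borel_measurable M" "(\<lambda>\<omega>. Y \<omega> \<bullet> (S *v Y \<omega>)) \<in> borel_measurable M"
    using L2_inner[OF assms(1) L2_matrix[OF assms(1)]] L2_inner[OF assms(2) L2_matrix[OF assms(2)]] by auto
  with assms(3) show ?thesis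
    unfolding E_quad_def by (intro integral_cong_AE) auto
qed

section \<open>Orthogonal decomposition into predictor and innovations\<close>

text \<open>\<open>p\<close> is the predictor of \<open>X = x\<^sub>k\<close> from \<open>n\<close> steps before its last noise, and \<open>w\<^bsub>k-1-i\<^esub> \<psi>\<^sub>i\<close> is the
  innovation brought by \<open>w\<^bsub>k-1-i\<^esub>\<close>. In the closed loop \<open>n = d\<close>; before time \<open>d\<close>, \<open>n = k\<close>.\<close>

definition decomp ::
  "nat \<Rightarrow> nat \<Rightarrow> ('a \<Rightarrow> real^'n) \<Rightarrow> ('a \<Rightarrow> real^'n) \<Rightarrow> (nat \<Rightarrow> 'a \<Rightarrow> real^'n) \<Rightarrow> bool" where
  "decomp n k X p \<psi> \<longleftrightarrow> n \<le> k \<and> L2 (int k - int n - 1) p \<and>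
     (\<forall>i<n. L2 (int k - int i - 2) (\<psi> i)) \<and>
     X = (\<lambda>\<omega>. p \<omega> + (\<Sum>i<n. w (k - 1 - i) \<omega> *\<^sub>R \<psi> i \<omega>))"

lemma decomp_0: "decomp 0 k X p \<psi> \<longleftrightarrow> L2 (int k - 1) X \<and> X = p"
  by (auto simp: decomp_def)

text \<open>Both vectors precede the oldest noise \<open>w (k - 1 - n)\<close>, which is the form
  \<open>pythagoras\<close> and \<open>L2_noise\<close> require. The natural subtraction is exact
  because \<open>Suc n \<le> k\<close>.\<close>

lemma decomp_SucD:
  assumes "decomp (Suc n) k X p \<psi>"
  shows "L2 (int (k - 1 - n) - 1) p" "L2 (int (k - 1 - n) - 1) (\<psi> n)"
proof -
  have k: "int (k - 1 - n) - 1 = int k - int n - 2"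
    using assms by (auto simp: decomp_def)
  have p: "L2 (int k - int (Suc n) - 1) p" and q: "L2 (int k - int n - 2) (\<psi> n)"
    using assms by (simp_all add: decomp_def)
  show "L2 (int (k - 1 - n) - 1) p" "L2 (int (k - 1 - n) - 1) (\<psi> n)"
    using L2_mono[OF p, of "int k - int n - 2"] q by (simp_all only: k)
qed

text \<open>Absorbing the oldest innovation into the predictor shortens the list by one. It drives
  the inductions on \<open>n\<close> and brings the list back to length \<open>d\<close> after a
  time step.\<close>

lemma decomp_peel:
  assumes "decomp (Suc n) k X p \<psi>"
  shows "decomp n k X (\<lambda>\<omega>. p \<omega> + w (k - 1 - n) \<omega> *\<^sub>R \<psi> n \<omega>) \<psi>"
proof -
  note D = decomp_SucD[OF assms]
  have k: "int (k - 1 - n) = int k - int n - 1"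
    using assms by (auto simp: decomp_def)
  have "L2 (int (k - 1 - n)) (\<lambda>\<omega>. p \<omega> + w (k - 1 - n) \<omega> *\<^sub>R \<psi> n \<omega>)"
    by (intro L2_add L2_mono[OF D(1)] L2_noise[OF D(2)]) simp
  then show ?thesis
    using assms unfolding k by (simp add: decomp_def ac_simps)
qed

lemma decomp_L2: "decomp n k X p \<psi> \<Longrightarrow> L2 (int k - 1) X"
proof (induction n arbitrary: p)
  case (Suc n)
  show ?case using Suc.IH[OF decomp_peel[OF Suc.prems]] .
qed (simp add: decomp_0)

lemma decomp_E_quad:
  "decomp n k X p \<psi> \<Longrightarrow> E_quad S X = E_quad S p + (\<Sum>i<n. E_quad S (\<psi> i))"
proof (induction n arbitrary: p)
  case (Suc n)
  show ?case
    using pythagoras[OF decomp_SucD[OF Suc.prems]] Suc.IH[OF decomp_peel[OF Suc.prems]]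
    by (simp add: E_quad_def)
qed (simp add: decomp_0)

text \<open>Peel off one innovation at a time: on a set \<open>D\<close> older than the noise, the
  innovation times the indicator of \<open>D\<close> is still noise times a past variable, so it
  integrates to 0.\<close>

lemma decomp_set_integral:
  assumes "decomp n k X p \<psi>" "D \<in> sets (F (int k - int n - 1))"
  shows "(\<integral>\<omega>\<in>D. X \<omega> $ j \<partial>M) = (\<integral>\<omega>\<in>D. p \<omega> $ j \<partial>M)"
  using assms
proof (induction n arbitrary: p)
  case (Suc n)
  define l where "l = k - 1 - n"
  have l: "int k - int (Suc n) - 1 = int l - 1"
    using Suc.prems by (auto simp: decomp_def l_def)
  have D: "D \<in> sets (F (int l - 1))"
    using Suc.prems(2) unfolding l .
  then have DM: "D \<in> sets M" and D': "D \<in> sets (F (int k - int n - 1))"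
    using subalgebra_F[of "int l - 1"] subalgebra_F_mono[of "int l - 1" "int k - int n - 1"] l
    by (auto simp: subalgebra_def)
  note p = L2_component[OF decomp_SucD(1)[OF Suc.prems(1)], of j]
  note q = L2_component[OF decomp_SucD(2)[OF Suc.prems(1)], of j]
  have "(\<lambda>\<omega>. indicator D \<omega> * \<psi> n \<omega> $ j) \<in> borel_measurable (F (int l - 1))"
    using D q by (auto simp: l_def)
  moreover have "integrable M (\<lambda>\<omega>. indicator D \<omega> * \<psi> n \<omega> $ j)"
    using integrable_mult_indicator[OF DM q(2)] by simp
  ultimately have z: "integrable M (\<lambda>\<omega>. w l \<omega> * (indicator D \<omega> * \<psi> n \<omega> $ j))"
    "(\<integral>\<omega>. w l \<omega> * (indicator D \<omega> * \<psi> n \<omega> $ j) \<partial>M) = 0"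
    by (rule noise_mult_past(1,2))+
  have "(\<integral>\<omega>\<in>D. X \<omega> $ j \<partial>M) = (\<integral>\<omega>\<in>D. (p \<omega> + w l \<omega> *\<^sub>R \<psi> n \<omega>) $ j \<partial>M)"
    using Suc.IH[OF decomp_peel[OF Suc.prems(1)] D'] by (simp add: l_def)
  also have "\<dots> = (\<integral>\<omega>. indicator D \<omega> * p \<omega> $ j + w l \<omega> * (indicator D \<omega> * \<psi> n \<omega> $ j) \<partial>M)"
    by (simp add: set_lebesgue_integral_def algebra_simps)
  also have "\<dots> = (\<integral>\<omega>\<in>D. p \<omega> $ j \<partial>M)"
    using z integrable_mult_indicator[OF DM p(2)] by (simp add: set_lebesgue_integral_def)
  finally show ?case .
qed (simp add: decomp_0)

text \<open>The vector \<open>p\<close> is measurable for the conditioning sigma-algebra and has the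
  same integrals as \<open>X\<close> over its sets, which characterizes the conditional expectation
  of each component.\<close>

lemma decomp_cond_exp:
  assumes "decomp n k X p \<psi>"
  shows "AE \<omega> in M. vec_cond_exp M (F (int k - int n - 1)) X \<omega> = p \<omega>"
proof -
  interpret sigma_finite_subalgebra M "F (int k - int n - 1)"
    by (intro finite_measure_subalgebra_is_sigma_finite finite_measure_subalgebra.intro
        finite_measure_subalgebra_axioms.intro subalgebra_F finite_measure_axioms)
  have p: "L2 (int k - int n - 1) p"
    using assms by (simp add: decomp_def)
  have "AE \<omega> in M. real_cond_exp M (F (int k - int n - 1)) (\<lambda>\<omega>. X \<omega> $ j) \<omega> = p \<omega> $ j" for j
    using decomp_set_integral[OF assms] L2_component[OF decomp_L2[OF assms]] L2_component[OF p]
    by (intro real_cond_exp_charact)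
  then have "AE \<omega> in M. \<forall>j. real_cond_exp M (F (int k - int n - 1)) (\<lambda>\<omega>. X \<omega> $ j) \<omega> = p \<omega> $ j"
    by (simp add: AE_all_countable)
  then show ?thesis
    by eventually_elim (simp add: vec_cond_exp_def vec_eq_iff)
qed

text \<open>The shift \<open>y\<close> is already known at the predictor's time, so only the
  predictor absorbs it.\<close>

lemma decomp_affine:
  fixes C :: "real^'n^'m"
  assumes "decomp n k X p \<psi>" "L2 (int k - int n - 1) y"
  shows "decomp n k (\<lambda>\<omega>. C *v X \<omega> + y \<omega>) (\<lambda>\<omega>. C *v p \<omega> + y \<omega>) (\<lambda>i \<omega>. C *v \<psi> i \<omega>)"
proof -
  have "L2 (int k - int n - 1) (\<lambda>\<omega>. C *v p \<omega> + y \<omega>)"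
    using assms by (intro L2_add L2_matrix) (simp_all add: decomp_def)
  moreover have "C *v (\<Sum>i<n. v i) = (\<Sum>i<n. C *v v i)" for v
    by (simp add: linear_sum[OF matrix_vector_mul_linear])
  ultimately show ?thesis
    using assms by (auto simp: decomp_def matrix_vector_right_distrib matrix_vector_mult_scaleR L2_matrix)
qed

text \<open>The new noise \<open>w k\<close> takes index 0 and the age of every older innovation
  increases by one.\<close>

lemma decomp_grow:
  fixes A Abar :: "real^'n^'n"
  assumes "decomp n k X p \<psi>" "L2 (int k - int n - 1) y" "L2 (int k - int n - 1) z"
  shows "decomp (Suc n) (Suc k) (\<lambda>\<omega>. (A *v X \<omega> + y \<omega>) + w k \<omega> *\<^sub>R (Abar *v X \<omega> + z \<omega>))
    (\<lambda>\<omega>. A *v p \<omega> + y \<omega>) (case_nat (\<lambda>\<omega>. Abar *v X \<omega> + z \<omega>) (\<lambda>i \<omega>. A *v \<psi> i \<omega>))"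
    (is "decomp _ _ ?X' ?p' ?\<psi>'")
proof -
  note 1 = decomp_affine[OF assms(1,2), of A]
  note 2 = decomp_affine[OF assms(1,3), of Abar]
  have "L2 (int (Suc k) - int i - 2) (?\<psi>' i)" if "i < Suc n" for i
    using 1 decomp_L2[OF 2] that by (cases i) (auto simp: decomp_def algebra_simps)
  moreover have "?X' \<omega> = ?p' \<omega> + (\<Sum>i<Suc n. w (Suc k - 1 - i) \<omega> *\<^sub>R ?\<psi>' i \<omega>)" for \<omega>
  proof -
    have "A *v X \<omega> + y \<omega> = ?p' \<omega> + (\<Sum>i<n. w (k - 1 - i) \<omega> *\<^sub>R (A *v \<psi> i \<omega>))"
      using 1 by (auto simp: decomp_def dest: fun_cong)
    then show ?thesis
      unfolding sum.lessThan_Suc_shift by simp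
  qed
  ultimately show ?thesis
    using 1 by (auto simp: decomp_def)
qed

end

subsection \<open>Lyapunov equations and stability\<close>

locale delayed_feedback = white_noise_space M w
  for M :: "'a measure" and w +
  fixes d :: nat and A Abar :: "real^'n^'n" and B Bbar :: "real^'m^'n" and K :: "real^'n^'m"
    and Q :: "real^'n^'n"
  assumes d: "d \<ge> 1" and Q: "pos_semidef Q"
begin

section \<open>Cost balance over one step of the closed loop\<close>

abbreviation "step \<equiv> feedback_step M w d A Abar B Bbar K"

text \<open>\<open>lyap S\<close> is the right-hand side of the coupled equations for the tuple \<open>S\<^sup>0, \<dots>, S\<^sup>d\<close>,
  and \<open>cost S\<close> weights the innovation of \<open>w\<^bsub>k-1-i\<^esub>\<close> by \<open>S\<^sup>i\<close> and the predictor by \<open>S\<^sup>d\<close>.\<close>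

definition lyap :: "(nat \<Rightarrow> real^'n^'n) \<Rightarrow> nat \<Rightarrow> real^'n^'n" where
  "lyap S i = (if i < d
     then transpose A ** S (Suc i) ** A + transpose Abar ** S 0 ** Abar + Q
     else transpose (A - B ** K) ** S d ** (A - B ** K)
        + transpose (Abar - Bbar ** K) ** S 0 ** (Abar - Bbar ** K) + Q)"

definition cost :: "(nat \<Rightarrow> real^'n^'n) \<Rightarrow> ('a \<Rightarrow> real^'n) \<Rightarrow> (nat \<Rightarrow> 'a \<Rightarrow> real^'n) \<Rightarrow> real" where
  "cost S p \<psi> = E_quad (S d) p + (\<Sum>i<d. E_quad (S i) (\<psi> i))"

text \<open>A step lengthens the decomposition to \<open>Suc d\<close> innovations; peeling the
  oldest restores length \<open>d\<close>. Orthogonality then splits every expected form, and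
  collecting the terms in \<open>p\<close> and in each \<open>\<psi> i\<close> produces
  \<open>lyap S\<close>.\<close>

lemma step_cost:
  assumes dec: "decomp d k X p \<psi>"
  obtains p' \<psi>' where "decomp d (Suc k) (step k X) p' \<psi>'"
    and "\<And>S. cost S p' \<psi>' + E_quad Q X = cost (lyap S) p \<psi>"
proof -
  define c where "c = vec_cond_exp M (F (int k - int d - 1)) X"
  have p: "L2 (int k - int d - 1) p" and \<psi>: "\<And>i. i < d \<Longrightarrow> L2 (int k - int i - 2) (\<psi> i)" and "d \<le> k"
    using dec by (auto simp: decomp_def)
  \<comment> \<open>The control uses a fixed version of the conditional expectation that equals
    \<open>p\<close> only almost surely. So \<open>y\<close> and \<open>z\<close> are built from
    \<open>c\<close>, and \<open>p\<close> replaces \<open>c\<close> only under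
    expectations.\<close>
  have cp: "AE \<omega> in M. c \<omega> = p \<omega>"
    unfolding c_def by (rule decomp_cond_exp[OF dec])
  have c: "L2 (int k - int d - 1) c"
    by (rule L2_AE_cong[OF p _ cp]) (simp add: c_def vec_cond_exp_measurable)
  define y where "y \<omega> = (- (B ** K)) *v c \<omega>" for \<omega>
  define z where "z \<omega> = (- (Bbar ** K)) *v c \<omega>" for \<omega>
  have y: "L2 (int k - int d - 1) y" and z: "L2 (int k - int d - 1) z"
    using L2_matrix[OF c, of "- (B ** K)"] L2_matrix[OF c, of "- (Bbar ** K)"]
    by (simp_all add: y_def[abs_def] z_def[abs_def])
  define X' where "X' \<omega> = (A *v X \<omega> + y \<omega>) + w k \<omega> *\<^sub>R (Abar *v X \<omega> + z \<omega>)" for \<omega>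
  have neg: "(- C) *v v = - (C *v v)" for C :: "real^'n^'n" and v
    using matrix_vector_mult_diff_rdistrib[of 0 C v] by simp
  have step: "step k X = X'"
    by (auto simp: feedback_step_def noisy_def X'_def y_def z_def c_def neg matrix_vector_mult_add_rdistrib
        scaleR_matrix_vector_assoc[symmetric] matrix_vector_mul_assoc[symmetric] algebra_simps fun_eq_iff)
  define \<psi>' where "\<psi>' = case_nat (\<lambda>\<omega>. Abar *v X \<omega> + z \<omega>) (\<lambda>i \<omega>. A *v \<psi> i \<omega>)"
  \<comment> \<open>After the step the noise of age \<open>d\<close> is
    \<open>w (Suc k - 1 - d)\<close>, that is \<open>w (k - d)\<close>; its innovation now joins the
    predictor.\<close>
  define p' where "p' \<omega> = A *v p \<omega> + y \<omega> + w (k - d) \<omega> *\<^sub>R \<psi>' d \<omega>" for \<omega>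
  have grow: "decomp (Suc d) (Suc k) X' (\<lambda>\<omega>. A *v p \<omega> + y \<omega>) \<psi>'"
    using decomp_grow[OF dec y z, of A Abar] by (simp add: X'_def[abs_def] \<psi>'_def)
  have peel: "decomp d (Suc k) X' p' \<psi>'"
    using decomp_peel[OF grow] by (simp add: p'_def[abs_def])
  have Ap: "E_quad S (\<lambda>\<omega>. A *v p \<omega> + y \<omega>) = E_quad (transpose (A - B ** K) ** S ** (A - B ** K)) p" for S
    unfolding E_quad_congruence
    by (rule E_quad_cong_AE[OF L2_add[OF L2_matrix[OF p] y] L2_matrix[OF p]])
      (use cp in eventually_elim, simp add: y_def neg matrix_vector_mult_diff_rdistrib)
  have Abp: "E_quad S (\<lambda>\<omega>. Abar *v p \<omega> + z \<omega>)
      = E_quad (transpose (Abar - Bbar ** K) ** S ** (Abar - Bbar ** K)) p" for S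
    unfolding E_quad_congruence
    by (rule E_quad_cong_AE[OF L2_add[OF L2_matrix[OF p] z] L2_matrix[OF p]])
      (use cp in eventually_elim, simp add: z_def neg matrix_vector_mult_diff_rdistrib)
  have "cost S p' \<psi>' + E_quad Q X = cost (lyap S) p \<psi>" for S
  proof -
    obtain e where e: "d = Suc e"
      using d by (cases d) auto
    have "E_quad (S d) p' = E_quad (S d) (\<lambda>\<omega>. A *v p \<omega> + y \<omega>) + E_quad (S d) (\<psi>' d)"
      using pythagoras[OF decomp_SucD[OF grow]] by (simp add: E_quad_def p'_def)
    then have "cost S p' \<psi>' = E_quad (S d) (\<lambda>\<omega>. A *v p \<omega> + y \<omega>) + (\<Sum>i<Suc d. E_quad (S i) (\<psi>' i))"
      by (simp add: cost_def)
    \<comment> \<open>Index 0 is the innovation of \<open>w k\<close>; the others have aged by one,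
      hence the weight \<open>S (Suc i)\<close>.\<close>
    also have "\<dots> = E_quad (S d) (\<lambda>\<omega>. A *v p \<omega> + y \<omega>) + E_quad (S 0) (\<lambda>\<omega>. Abar *v X \<omega> + z \<omega>)
        + (\<Sum>i<d. E_quad (S (Suc i)) (\<lambda>\<omega>. A *v \<psi> i \<omega>))"
      unfolding sum.lessThan_Suc_shift by (simp add: \<psi>'_def)
    \<comment> \<open>The innovation of \<open>w k\<close> contains the whole state, so
      \<open>S 0\<close> enters the equation of every index.\<close>
    also have "E_quad (S 0) (\<lambda>\<omega>. Abar *v X \<omega> + z \<omega>)
        = E_quad (S 0) (\<lambda>\<omega>. Abar *v p \<omega> + z \<omega>) + (\<Sum>i<d. E_quad (S 0) (\<lambda>\<omega>. Abar *v \<psi> i \<omega>))"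
      using decomp_E_quad[OF decomp_affine[OF dec z]] .
    finally have "cost S p' \<psi>' + E_quad Q X
        = E_quad (S d) (\<lambda>\<omega>. A *v p \<omega> + y \<omega>) + E_quad (S 0) (\<lambda>\<omega>. Abar *v p \<omega> + z \<omega>) + E_quad Q p
        + (\<Sum>i<d. E_quad (S (Suc i)) (\<lambda>\<omega>. A *v \<psi> i \<omega>) + E_quad (S 0) (\<lambda>\<omega>. Abar *v \<psi> i \<omega>) + E_quad Q (\<psi> i))"
      using decomp_E_quad[OF dec, of Q] by (simp add: sum.distrib)
    also have "\<dots> = cost (lyap S) p \<psi>"
      unfolding cost_def Ap Abp E_quad_congruence[symmetric]
      by (simp add: lyap_def E_quad_add[OF p] E_quad_add[OF \<psi>])
    finally show ?thesis .
  qed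
  with peel that show thesis
    by (simp add: step)
qed

section \<open>Finite-horizon observability Gramians by value iteration from zero\<close>

definition gramian :: "nat \<Rightarrow> nat \<Rightarrow> real^'n^'n" where
  "gramian N = (lyap ^^ N) (\<lambda>_. 0)"

lemma gramian_0: "gramian 0 = (\<lambda>_. 0)"
  and gramian_Suc: "gramian (Suc N) = lyap (gramian N)"
  by (simp_all add: gramian_def)

lemma cost_zero: "cost (\<lambda>_. 0) p \<psi> = 0"
  by (simp add: cost_def E_quad_def)

text \<open>Iterating \<open>step_cost\<close> trades one application of \<open>lyap\<close> for one
  term of output energy, until the zero tuple leaves no terminal cost.\<close>

lemma output_energy:
  assumes "decomp d k (x k) p \<psi>" "\<And>l. k \<le> l \<Longrightarrow> x (Suc l) = step l (x l)"
  shows "(\<Sum>t<N. E_quad Q (x (k + t))) = cost (gramian N) p \<psi>"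
  using assms
proof (induction N arbitrary: k p \<psi>)
  case (Suc N)
  obtain p' \<psi>' where dec: "decomp d (Suc k) (x (Suc k)) p' \<psi>'"
    and "cost (gramian N) p' \<psi>' + E_quad Q (x k) = cost (gramian (Suc N)) p \<psi>"
    using step_cost[OF Suc.prems(1)] Suc.prems(2) unfolding gramian_Suc by (metis order_refl)
  moreover have "(\<Sum>t<N. E_quad Q (x (Suc k + t))) = cost (gramian N) p' \<psi>'"
    using Suc.prems(2) by (intro Suc.IH[OF dec]) auto
  ultimately show ?case
    unfolding sum.lessThan_Suc_shift by simp
qed (simp add: gramian_0 cost_zero)

lemma trajectory_decomp:
  assumes "decomp d k (x k) p \<psi>" "\<And>l. k \<le> l \<Longrightarrow> x (Suc l) = step l (x l)" "k \<le> l"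
  shows "\<exists>p \<psi>. decomp d l (x l) p \<psi>"
  using assms(3)
proof (induction l rule: dec_induct)
  case base
  then show ?case using assms(1) by blast
next
  case (step l)
  then show ?case using assms(2) by (metis step_cost)
qed

lemma E_quad_Q_nonneg: "0 \<le> E_quad Q X"
  unfolding E_quad_def using Q by (intro integral_nonneg_AE) (auto simp: pos_semidef_def)

lemma cost_mono:
  assumes "decomp d k X p \<psi>" "\<And>i v. i \<le> d \<Longrightarrow> v \<bullet> (S i *v v) \<le> v \<bullet> (T i *v v)"
  shows "cost S p \<psi> \<le> cost T p \<psi>"
  unfolding cost_def
proof (intro add_mono sum_mono)
  have "L2 (int k - int d - 1) p"
    using assms(1) by (simp add: decomp_def)
  then show "E_quad (S d) p \<le> E_quad (T d) p"
    by (rule E_quad_mono) (simp add: assms(2))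
  fix i assume "i \<in> {..<d}"
  then have "L2 (int k - int i - 2) (\<psi> i)"
    using assms(1) by (simp add: decomp_def)
  then show "E_quad (S i) (\<psi> i) \<le> E_quad (T i) (\<psi> i)"
    by (rule E_quad_mono) (use \<open>i \<in> {..<d}\<close> in \<open>simp add: assms(2)\<close>)
qed

text \<open>With equal weights the orthogonal pieces reassemble the state; this links
  \<open>cost\<close> to the second moment of \<open>X\<close>.\<close>

lemma cost_const: "decomp d k X p \<psi> \<Longrightarrow> cost (\<lambda>_. S) p \<psi> = E_quad S X"
  by (simp add: cost_def decomp_E_quad)

text \<open>The elementary states \<open>v\<close> and \<open>w\<^sub>l v\<close> (for \<open>l < d\<close>) already detect every matrix of the tuple \<open>S\<close>.\<close>
lemma elementary_state:
  assumes "i \<le> d"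
  obtains X p \<psi> where "decomp d d X p \<psi>" "\<And>S. cost S p \<psi> = v \<bullet> (S i *v v)"
proof (cases "i = d")
  case True
  have "decomp d d (\<lambda>_. v) (\<lambda>_. v) (\<lambda>_ _. 0)"
    by (auto simp: decomp_def L2_const)
  moreover have "cost S (\<lambda>_. v) (\<lambda>_ _. 0) = v \<bullet> (S i *v v)" for S
    by (simp add: cost_def E_quad_const True)
  ultimately show thesis by (rule that)
next
  case False
  \<comment> \<open>At time \<open>d\<close> index \<open>i\<close> belongs to the noise
    \<open>w (d - 1 - i)\<close>, so the state is that noise times the fixed vector
    \<open>v\<close>.\<close>
  define \<psi> :: "nat \<Rightarrow> 'a \<Rightarrow> real^'n" where "\<psi> j = (if j = i then (\<lambda>_. v) else (\<lambda>_. 0))" for j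
  have "decomp d d (\<lambda>\<omega>. \<Sum>j<d. w (d - 1 - j) \<omega> *\<^sub>R \<psi> j \<omega>) (\<lambda>_. 0) \<psi>"
    by (auto simp: decomp_def \<psi>_def L2_const)
  moreover have "cost S (\<lambda>_. 0) \<psi> = v \<bullet> (S i *v v)" for S
  proof -
    have "E_quad (S j) (\<psi> j) = (if j = i then v \<bullet> (S i *v v) else 0)" for j
      by (simp add: \<psi>_def E_quad_const)
    then show ?thesis
      using False assms by (simp add: cost_def E_quad_const)
  qed
  ultimately show thesis by (rule that)
qed

lemma trajectory_exists:
  obtains x where "x k = X" "\<And>l. k \<le> l \<Longrightarrow> x (Suc l) = step l (x l)"
proof -
  define x where "x l = rec_nat X (\<lambda>n. step (k + n)) (l - k)" for l
  show thesis
  proof (rule that)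
    show "x k = X" by (simp add: x_def)
    show "x (Suc l) = step l (x l)" if "k \<le> l" for l
      using that by (simp add: x_def Suc_diff_le)
  qed
qed

lemma elementary_trajectory:
  assumes "i \<le> d"
  obtains x p \<psi> where "decomp d d (x d) p \<psi>" "\<And>l. d \<le> l \<Longrightarrow> x (Suc l) = step l (x l)"
    and "\<And>S. cost S p \<psi> = v \<bullet> (S i *v v)"
    and "\<And>N. (\<Sum>t<N. E_quad Q (x (d + t))) = v \<bullet> (gramian N i *v v)"
proof -
  obtain X p \<psi> where X: "decomp d d X p \<psi>" "\<And>S. cost S p \<psi> = v \<bullet> (S i *v v)"
    using elementary_state[OF assms] by blast
  obtain x where x: "x d = X" "\<And>l. d \<le> l \<Longrightarrow> x (Suc l) = step l (x l)"
    using trajectory_exists by blast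
  have "(\<Sum>t<N. E_quad Q (x (d + t))) = v \<bullet> (gramian N i *v v)" for N
    using output_energy[of d x, OF _ x(2)] X x(1) by metis
  with X x that show thesis by metis
qed

text \<open>Both sides are output energies of the same elementary trajectory, and a longer window
  only adds nonnegative terms.\<close>

lemma gramian_mono:
  assumes "i \<le> d" "N \<le> N'"
  shows "v \<bullet> (gramian N i *v v) \<le> v \<bullet> (gramian N' i *v v)"
proof -
  obtain x where x: "\<And>N. (\<Sum>t<N. E_quad Q (x (d + t))) = v \<bullet> (gramian N i *v v)"
    using elementary_trajectory[OF assms(1)] by metis
  show ?thesis
    unfolding x[symmetric] using assms(2) E_quad_Q_nonneg by (intro sum_mono2) auto
qed

text \<open>Otherwise an elementary trajectory would have zero output energy over every window,
  hence almost surely zero output, and observability would annihilate its initial state.\<close>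

lemma gramian_pos:
  assumes obs: "exactly_observable M w d A Abar B Bbar K (psd_sqrt Q)"
    and "i \<le> d" "v \<noteq> 0"
  shows "\<exists>N. 0 < v \<bullet> (gramian N i *v v)"
proof (rule ccontr)
  assume "\<not> ?thesis"
  then have le: "v \<bullet> (gramian N i *v v) \<le> 0" for N by (simp add: not_less)
  obtain x p \<psi> where dec: "decomp d d (x d) p \<psi>" and x: "\<And>l. d \<le> l \<Longrightarrow> x (Suc l) = step l (x l)"
    and cost: "\<And>S. cost S p \<psi> = v \<bullet> (S i *v v)"
    and energy: "\<And>N. (\<Sum>t<N. E_quad Q (x (d + t))) = v \<bullet> (gramian N i *v v)"
    using elementary_trajectory[OF \<open>i \<le> d\<close>] by metis
  have zero: "E_quad Q (x k) = 0" if "d \<le> k" for k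
  proof -
    have "E_quad Q (x (d + (k - d))) \<le> (\<Sum>t<Suc (k - d). E_quad Q (x (d + t)))"
      by (intro member_le_sum E_quad_Q_nonneg) auto
    then show ?thesis
      using le[of "Suc (k - d)"] E_quad_Q_nonneg[of "x k"] that unfolding energy by simp
  qed
  have out: "AE \<omega> in M. psd_sqrt Q *v x k \<omega> = 0" if k: "d \<le> k" for k
  proof -
    obtain p \<psi> where "decomp d k (x k) p \<psi>"
      using trajectory_decomp[of d x, OF dec x k] by auto
    then have "L2 (int k - 1) (x k)"
      by (rule decomp_L2)
    then have "integrable M (\<lambda>\<omega>. x k \<omega> \<bullet> (Q *v x k \<omega>))"
      by (intro L2_inner L2_matrix)
    then have "AE \<omega> in M. x k \<omega> \<bullet> (Q *v x k \<omega>) = 0"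
      using integral_nonneg_eq_0_iff_AE[of M "\<lambda>\<omega>. x k \<omega> \<bullet> (Q *v x k \<omega>)"] zero[OF k] Q
      by (auto simp: E_quad_def pos_semidef_def)
    then show ?thesis
      by eventually_elim (rule psd_sqrt_kernel[OF Q])
  qed
  have L2d: "L2 (int d - 1) (x d)"
    using dec by (rule decomp_L2)
  then have "AE \<omega> in M. x d \<omega> = 0"
    using obs[unfolded exactly_observable_def, rule_format, of d x] x out by (auto simp: L2_def)
  \<comment> \<open>Identity weights give the second moment of \<open>x d\<close>, which for the
    elementary state equals \<open>v \<bullet> v\<close>.\<close>
  then have "E_quad (mat 1) (x d) = E_quad (mat 1) (\<lambda>_. 0 :: real^'n)"
    by (intro E_quad_cong_AE[OF L2d L2_const[of 0]])
  then have "v \<bullet> (mat 1 *v v) = 0"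
    using cost_const[OF dec, of "mat 1"] cost[of "\<lambda>_. mat 1"] by (simp add: E_quad_const)
  then show False
    using \<open>v \<noteq> 0\<close> by simp
qed

text \<open>The open positivity sets cover the unit sphere. A finite subcover and monotonicity in
  \<open>N\<close> give one horizon that is positive on the whole sphere; the minimum there is the
  constant, and scaling extends the bound to all vectors.\<close>

lemma gramian_coercive:
  assumes obs: "exactly_observable M w d A Abar B Bbar K (psd_sqrt Q)" and "i \<le> d"
  shows "\<exists>N. \<exists>g>0. \<forall>v. g * (v \<bullet> v) \<le> v \<bullet> (gramian N i *v v)"
proof -
  let ?S = "sphere 0 1 :: (real^'n) set"
  define q where "q N v = v \<bullet> (gramian N i *v v)" for N v
  have cont: "continuous_on UNIV (q N)" for N
    unfolding q_def
    by (intro continuous_intros linear_continuous_on linear_conv_bounded_linear[THEN iffD1]) simp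
  have cover: "?S \<subseteq> (\<Union>N. {v. 0 < q N v})"
  proof
    fix v assume "v \<in> ?S"
    then have "v \<noteq> 0" by auto
    from gramian_pos[OF obs \<open>i \<le> d\<close> this] show "v \<in> (\<Union>N. {v. 0 < q N v})"
      by (simp add: q_def)
  qed
  have op: "open {v. 0 < q N v}" for N
    using cont by (intro open_Collect_less continuous_on_const)
  obtain J where J: "finite J" "?S \<subseteq> (\<Union>N\<in>J. {v. 0 < q N v})"
    by (rule compactE_image[OF compact_sphere op cover])
  \<comment> \<open>Inserting 0 keeps the argument of \<open>Max\<close> nonempty.\<close>
  define N where "N = Max (insert 0 J)"
  have pos: "0 < q N v" if v: "v \<in> ?S" for v
  proof -
    obtain N' where "N' \<in> J" "0 < q N' v" using J v by auto
    moreover from this have "N' \<le> N" using J(1) by (simp add: N_def)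
    ultimately show ?thesis
      using gramian_mono[OF \<open>i \<le> d\<close>, of N' N v] by (simp add: q_def)
  qed
  have "?S \<noteq> {}" by simp
  then obtain u where u: "u \<in> ?S" "\<And>v. v \<in> ?S \<Longrightarrow> q N u \<le> q N v"
    using continuous_attains_inf[OF compact_sphere, of 0 1 "q N"] continuous_on_subset[OF cont] by blast
  have "q N u * (v \<bullet> v) \<le> v \<bullet> (gramian N i *v v)" for v
  proof (cases "v = 0")
    case False
    then have "q N u \<le> q N (v /\<^sub>R norm v)"
      by (intro u) simp
    also have "\<dots> = (v \<bullet> (gramian N i *v v)) / (norm v)\<^sup>2"
      by (simp add: q_def matrix_vector_mult_scaleR power2_eq_square divide_inverse mult_ac)
    finally show ?thesis
      using False by (simp add: le_divide_eq power2_norm_eq_inner)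
  qed simp
  with pos[OF u(1)] show ?thesis by blast
qed

text \<open>Finitely many indices allow the least constant and the largest horizon, the latter by
  \<open>gramian_mono\<close>.\<close>

lemma gramian_uniform:
  assumes obs: "exactly_observable M w d A Abar B Bbar K (psd_sqrt Q)"
  shows "\<exists>g>0. \<exists>N. \<forall>i\<le>d. \<forall>v. g * (v \<bullet> v) \<le> v \<bullet> (gramian N i *v v)"
proof -
  have "\<forall>i\<in>{..d}. \<exists>N g. g > 0 \<and> (\<forall>v. g * (v \<bullet> v) \<le> v \<bullet> (gramian N i *v v))"
    using gramian_coercive[OF obs] by blast
  then obtain N g where Ng: "\<And>i. i \<le> d \<Longrightarrow> g i > 0"
      "\<And>i (v::real^'n). i \<le> d \<Longrightarrow> g i * (v \<bullet> v) \<le> v \<bullet> (gramian (N i) i *v v)"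
    by (metis atMost_iff)
  show ?thesis
  proof (intro exI[of _ "Min (g ` {..d})"] exI[of _ "Max (N ` {..d})"] conjI allI impI)
    show "Min (g ` {..d}) > 0" using Ng by simp
    fix i and v :: "real^'n" assume "i \<le> d"
    then have "Min (g ` {..d}) * (v \<bullet> v) \<le> g i * (v \<bullet> v)"
      by (intro mult_right_mono Min_le) auto
    also have "\<dots> \<le> v \<bullet> (gramian (N i) i *v v)"
      using Ng \<open>i \<le> d\<close> by blast
    also have "\<dots> \<le> v \<bullet> (gramian (Max (N ` {..d})) i *v v)"
      using \<open>i \<le> d\<close> by (intro gramian_mono) auto
    finally show "Min (g ` {..d}) * (v \<bullet> v) \<le> v \<bullet> (gramian (Max (N ` {..d})) i *v v)" .
  qed
qed

text \<open>The map \<open>lyap\<close> is monotone, so iterating it from zero never rises above a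
  nonnegative fixed point.\<close>

lemma gramian_le:
  assumes P: "\<And>i v. i \<le> d \<Longrightarrow> 0 \<le> v \<bullet> (P i *v v)" "\<And>i. i \<le> d \<Longrightarrow> lyap P i = P i"
    and "i \<le> d"
  shows "v \<bullet> (gramian N i *v v) \<le> v \<bullet> (P i *v v)"
  using \<open>i \<le> d\<close>
proof (induction N arbitrary: i v)
  case 0
  then show ?case using P(1) by (simp add: gramian_0)
next
  case (Suc N)
  have "v \<bullet> (lyap (gramian N) i *v v) \<le> v \<bullet> (lyap P i *v v)"
    using Suc.IH Suc.prems
    by (auto simp: lyap_def matrix_vector_mult_add_rdistrib inner_add form_congruence intro!: add_mono)
  then show ?case
    using P(2) Suc.prems by (simp add: gramian_Suc)
qed

section \<open>Mean-square decay and the initial phase\<close>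

lemma ms_decay:
  assumes obs: "exactly_observable M w d A Abar B Bbar K (psd_sqrt Q)"
    and P: "\<And>i v. i \<le> d \<Longrightarrow> 0 \<le> v \<bullet> (P i *v v)" "\<And>i. i \<le> d \<Longrightarrow> lyap P i = P i"
    and dec: "decomp d d (x d) p \<psi>" and x: "\<And>l. d \<le> l \<Longrightarrow> x (Suc l) = step l (x l)"
  shows "(\<lambda>k. \<integral>\<omega>. x k \<omega> \<bullet> x k \<omega> \<partial>M) \<longlonglongrightarrow> 0"
proof -
  obtain g N where g: "g > 0" "\<And>i v. i \<le> d \<Longrightarrow> g * (v \<bullet> v) \<le> v \<bullet> (gramian N i *v v)"
    using gramian_uniform[OF obs] by metis
  have energy: "(\<Sum>t<T. E_quad Q (x (d + t))) = cost (gramian T) p \<psi>" for T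
    by (rule output_energy[where x=x, OF dec x])
  \<comment> \<open>The bound does not depend on \<open>T\<close>, so the nonnegative output
    energies are summable.\<close>
  have "(\<Sum>t<T. E_quad Q (x (d + t))) \<le> cost P p \<psi>" for T
    unfolding energy by (intro cost_mono[OF dec] gramian_le[OF P])
  then have "summable (\<lambda>t. E_quad Q (x (d + t)))"
    using E_quad_Q_nonneg
    by (intro bounded_imp_summable[of _ "cost P p \<psi>"]) (simp_all only: flip: lessThan_Suc_atMost)
  then have "(\<lambda>t. E_quad Q (x (t + d))) \<longlonglongrightarrow> 0"
    by (subst add.commute) (rule summable_LIMSEQ_zero)
  then have lim: "(\<lambda>k. E_quad Q (x k)) \<longlonglongrightarrow> 0"
    by (rule LIMSEQ_offset)
  \<comment> \<open>The window length \<open>N\<close> is fixed, so this is a finite sum of null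
    sequences.\<close>
  have "(\<lambda>k. \<Sum>t<N. E_quad Q (x (k + t))) \<longlonglongrightarrow> (\<Sum>t<N. 0)"
    by (intro tendsto_sum LIMSEQ_ignore_initial_segment[OF lim])
  then have lim0: "(\<lambda>k. (\<Sum>t<N. E_quad Q (x (k + t))) / g) \<longlonglongrightarrow> 0"
    using tendsto_divide[OF _ tendsto_const[of g sequentially]] g(1) by force
  have "(\<integral>\<omega>. x k \<omega> \<bullet> x k \<omega> \<partial>M) \<le> (\<Sum>t<N. E_quad Q (x (k + t))) / g" if k: "d \<le> k" for k
  proof -
    obtain p' \<psi>' where dec': "decomp d k (x k) p' \<psi>'"
      using trajectory_decomp[of d x, OF dec x k] by auto
    have "g * (\<integral>\<omega>. x k \<omega> \<bullet> x k \<omega> \<partial>M) = E_quad (g *\<^sub>R mat 1) (x k)"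
      by (simp add: E_quad_def scaleR_matrix_vector_assoc[symmetric])
    also have "\<dots> = cost (\<lambda>_. g *\<^sub>R mat 1) p' \<psi>'"
      using cost_const[OF dec'] by simp
    \<comment> \<open>The Gramians do not depend on time, so the coercivity found at time
      \<open>d\<close> applies to the decomposition at any later \<open>k\<close>.\<close>
    also have "\<dots> \<le> cost (gramian N) p' \<psi>'"
      using g by (intro cost_mono[OF dec']) (simp add: scaleR_matrix_vector_assoc[symmetric])
    also have "\<dots> = (\<Sum>t<N. E_quad Q (x (k + t)))"
      using output_energy[of k x, OF dec'] x k by simp
    finally show ?thesis
      using g(1) by (simp add: le_divide_eq mult.commute)
  qed
  then have le: "\<forall>\<^sub>F k in sequentially. (\<integral>\<omega>. x k \<omega> \<bullet> x k \<omega> \<partial>M) \<le> (\<Sum>t<N. E_quad Q (x (k + t))) / g"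
    by (rule eventually_sequentiallyI)
  have "\<forall>\<^sub>F k in sequentially. 0 \<le> (\<integral>\<omega>. x k \<omega> \<bullet> x k \<omega> \<partial>M)"
    by (intro always_eventually allI integral_nonneg_AE) simp
  from tendsto_sandwich[OF this le tendsto_const lim0] show ?thesis .
qed

lemma initial_decomp:
  assumes "closed_loop M w d A Abar B Bbar K x0 u x" "k \<le> d"
  shows "\<exists>p \<psi>. decomp k k (x k) p \<psi>"
  using assms(2)
proof (induction k)
  case 0
  have "decomp 0 0 (x 0) (\<lambda>_. x0) (\<lambda>_ _. 0)"
    using assms(1) by (simp add: closed_loop_def decomp_0 L2_const)
  then show ?case by blast
next
  case (Suc k)
  then obtain p \<psi> where "decomp k k (x k) p \<psi>" by auto
  \<comment> \<open>The initial input is deterministic and hence \<open>L2\<close> at every index.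
    Each step adds one noise, so at time \<open>k\<close> all \<open>k\<close> past noises are
    innovations and the predictor is measurable for \<open>F (-1)\<close>.\<close>
  from decomp_grow[OF this L2_const L2_const, of A "B *v u (int k - int d)" Abar "Bbar *v u (int k - int d)"]
  have "\<exists>p \<psi>. decomp (Suc k) (Suc k) (\<lambda>\<omega>. (A *v x k \<omega> + B *v u (int k - int d))
      + w k \<omega> *\<^sub>R (Abar *v x k \<omega> + Bbar *v u (int k - int d))) p \<psi>"
    by blast
  moreover have "x (Suc k) = (\<lambda>\<omega>. (A *v x k \<omega> + B *v u (int k - int d))
      + w k \<omega> *\<^sub>R (Abar *v x k \<omega> + Bbar *v u (int k - int d)))"
    using assms(1) Suc.prems
    by (auto simp: closed_loop_def noisy_def matrix_vector_mult_add_rdistrib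
        scaleR_matrix_vector_assoc[symmetric] algebra_simps)
  ultimately show ?case by simp
qed

lemma ms_stable_if_observable:
  assumes obs: "exactly_observable M w d A Abar B Bbar K (psd_sqrt Q)"
    and P: "\<And>i v. i \<le> d \<Longrightarrow> 0 \<le> v \<bullet> (P i *v v)" "\<And>i. i \<le> d \<Longrightarrow> lyap P i = P i"
  shows "ms_stable M w d A Abar B Bbar K"
  unfolding ms_stable_def
proof (intro allI impI conjI)
  fix x0 u x assume cl: "closed_loop M w d A Abar B Bbar K x0 u x"
  have x: "x (Suc l) = step l (x l)" if "d \<le> l" for l
    using cl that by (simp add: closed_loop_def)
  obtain p \<psi> where dec: "decomp d d (x d) p \<psi>"
    using initial_decomp[OF cl order_refl] by blast
  show "(\<lambda>k. \<integral>\<omega>. x k \<omega> \<bullet> x k \<omega> \<partial>M) \<longlonglongrightarrow> 0"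
    by (rule ms_decay[where x=x, OF obs P dec x])
  fix k
  \<comment> \<open>Integrability is required at every time, so the initial phase and the feedback
    phase are both covered.\<close>
  have "\<exists>n p \<psi>. decomp n k (x k) p \<psi>"
    using initial_decomp[OF cl, of k] trajectory_decomp[of d x, OF dec x, of k] by (meson nat_le_linear)
  then show "integrable M (\<lambda>\<omega>. x k \<omega> \<bullet> x k \<omega>)"
    using decomp_L2 L2_def by blast
qed

end

theorem lemma3:
  fixes M :: "'a measure" and w :: "nat \<Rightarrow> 'a \<Rightarrow> real" and d :: nat
    and A Abar Q :: "real^'n^'n" and B Bbar :: "real^'m^'n" and K :: "real^'n^'m"
    and P :: "nat \<Rightarrow> real^'n^'n"
  assumes "prob_space M"
    and "white_noise M w"
    and "d \<ge> 1"
    and "pos_semidef Q"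
    and "exactly_observable M w d A Abar B Bbar K (psd_sqrt Q)"
    and "\<And>i. i \<le> d \<Longrightarrow> pos_def (P i)"
    and "\<And>i. 1 \<le> i \<Longrightarrow> i \<le> d \<Longrightarrow>
           P (i - 1) = transpose A ** P i ** A + transpose Abar ** P 0 ** Abar + Q"
    and "P d = transpose (A - B ** K) ** P d ** (A - B ** K)
             + transpose (Abar - Bbar ** K) ** P 0 ** (Abar - Bbar ** K) + Q"
  shows "ms_stable M w d A Abar B Bbar K"
proof -
  interpret delayed_feedback M w d A Abar B Bbar K Q
    using assms(1-4)
    by (intro delayed_feedback.intro white_noise_space.intro white_noise_space_axioms.intro
        delayed_feedback_axioms.intro)
  show ?thesis
  proof (rule ms_stable_if_observable[OF assms(5)])
    fix i assume "i \<le> d"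
    \<comment> \<open>For \<open>i < d\<close> the coupled equation is taken at
      \<open>Suc i\<close>, since it expresses \<open>P (i - 1)\<close> through
      \<open>P i\<close>.\<close>
    then show "lyap P i = P i"
      using assms(7)[of "Suc i"] assms(8) by (cases "i = d") (auto simp: lyap_def)
    show "0 \<le> v \<bullet> (P i *v v)" for v
      using assms(6)[OF \<open>i \<le> d\<close>] by (cases "v = 0") (auto simp: pos_def_def less_imp_le)
  qed
qed

end
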